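(* Let $G$ be a non-complete graph with chromatic number $\chi(G)=k$, and let $V_1,V_2,\dots,V_k$ be the colour classes of a proper $k$-colouring of $G$ with $|V_1|\le|V_2|\le\cdots\le|V_k|$. (1) If there is an $\ell\ge1$ such that $|V_i|=1$ for $1\le i\le\ell$ and $|V_i|>1$ for $\ell<i\le k$, then $\tau_s(G)\le \ell-1+\sum_{i=\ell+1}^{k}\lceil\log_2|V_i|\rceil$. (2) If $|V_1|\ge2$, then $\tau_s(G)\le\sum_{i=1}^{k}\lceil\log_2|V_i|\rceil$.
   Context: For vertices $u,v,w$ of a connected graph, $w$ strongly resolves $u,v$ if there is a shortest $u$-$w$ path containing $v$ or a shortest $v$-$w$ path containing $u$. A strong resolving set is a set $W$ such that every pair of vertices is strongly resolved by some vertex of $W$; the strong dimension $\beta_s(H)$ is the minimum size of a strong resolving set of $H$. The threshold strong dimension $\tau_s(G)$ is the minimum of $\beta_s(H)$ over all (connected) graphs $H$ having $G$ as a spanning subgraph. *)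

theory Defs
  imports Complex_Main "Graph_Theory.Graph_Theory"
begin

text \<open>
  A finite simple undirected graph is a \<open>pair_graph\<close>: each edge \<open>{u, v}\<close> is the pair of
  arcs \<open>(u, v)\<close>, \<open>(v, u)\<close>. Since arcs are pairs of vertices, every simple graph on the vertex set
  of \<open>G\<close> is a value of the type of \<open>G\<close>, so spanning supergraphs can be quantified within that type.
\<close>

definition shortest_path :: "'a pair_pre_digraph \<Rightarrow> 'a \<Rightarrow> ('a \<times> 'a) list \<Rightarrow> 'a \<Rightarrow> bool" where
  "shortest_path H u p w \<longleftrightarrow>
     pre_digraph.apath (with_proj H) u p w \<and>
     (\<forall>q. pre_digraph.apath (with_proj H) u q w \<longrightarrow> length p \<le> length q)"

definition strongly_resolves :: "'a pair_pre_digraph \<Rightarrow> 'a \<Rightarrow> 'a \<Rightarrow> 'a \<Rightarrow> bool" where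
  "strongly_resolves H w u v \<longleftrightarrow>
     (\<exists>p. shortest_path H u p w \<and> v \<in> set (pre_digraph.awalk_verts (with_proj H) u p)) \<or>
     (\<exists>p. shortest_path H v p w \<and> u \<in> set (pre_digraph.awalk_verts (with_proj H) v p))"

definition strong_resolving_set :: "'a pair_pre_digraph \<Rightarrow> 'a set \<Rightarrow> bool" where
  "strong_resolving_set H W \<longleftrightarrow>
     W \<subseteq> pverts H \<and>
     (\<forall>u \<in> pverts H. \<forall>v \<in> pverts H. u \<noteq> v \<longrightarrow> (\<exists>w \<in> W. strongly_resolves H w u v))"

definition strong_dimension :: "'a pair_pre_digraph \<Rightarrow> nat" where
  "strong_dimension H = (LEAST n. \<exists>W. strong_resolving_set H W \<and> card W = n)"

text \<open>
  \<open>G\<close> itself need not be connected, only the supergraphs \<open>H\<close>. For nonempty \<open>G\<close> the complete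
  graph on the vertices of \<open>G\<close> is an admissible \<open>H\<close>, so the minimum is attained.
\<close>

definition threshold_strong_dimension :: "'a pair_pre_digraph \<Rightarrow> nat" where
  "threshold_strong_dimension G =
     (LEAST n. \<exists>H :: 'a pair_pre_digraph.
        pair_graph H \<and> Digraph_Component.connected (with_proj H) \<and>
        spanning (with_proj G) (with_proj H) \<and> strong_dimension H = n)"

definition proper_colouring :: "'a pair_pre_digraph \<Rightarrow> nat \<Rightarrow> ('a \<Rightarrow> nat) \<Rightarrow> bool" where
  "proper_colouring G k c \<longleftrightarrow>
     (\<forall>v \<in> pverts G. c v \<in> {1..k}) \<and> (\<forall>(u, v) \<in> parcs G. c u \<noteq> c v)"

definition chromatic_number :: "'a pair_pre_digraph \<Rightarrow> nat" where
  "chromatic_number G = (LEAST k. \<exists>c. proper_colouring G k c)"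

definition colour_class :: "'a pair_pre_digraph \<Rightarrow> ('a \<Rightarrow> nat) \<Rightarrow> nat \<Rightarrow> 'a set" where
  "colour_class G c i = {v \<in> pverts G. c v = i}"

end

theory Submission
  imports Defs
begin

text \<open>
  In a connected graph a vertex strongly resolves all pairs it belongs to, and a pair of
  adjacent vertices is resolved by any third vertex adjacent to exactly one of them. So if the
  complement of a vertex set \<open>W\<close> is a clique whose members have pairwise different neighbourhoods in \<open>W\<close>, then
  \<open>W\<close> is strongly resolving. Such a supergraph of \<open>G\<close> arises by choosing about \<open>log\<^sub>2 \<bar>V\<^sub>i\<bar>\<close> vertices
  of every colour class \<open>V\<^sub>i\<close>, joining distinct classes completely, and separating the remaining vertices
  of \<open>V\<^sub>i\<close> by distinct proper subsets of the chosen part of \<open>V\<^sub>i\<close>. Properness of the subsets separates vertices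
  of different classes and leaves room for one universal vertex \<open>x0\<close> outside \<open>W\<close>, which yields
  connectedness and, taken from a singleton class, the term \<open>-1\<close>.
\<close>

section \<open>Strong resolution by explicit shortest paths\<close>

lemma shortest_path_exists:
  assumes "wf_digraph (with_proj H)" "u \<rightarrow>\<^sup>*\<^bsub>with_proj H\<^esub> v"
  shows "\<exists>p. shortest_path H u p v"
proof -
  have "\<exists>p. pre_digraph.apath (with_proj H) u p v"
    using assms(2) unfolding wf_digraph.reachable_apath[OF assms(1)] .
  then show ?thesis
    unfolding shortest_path_def
    using ex_has_least_nat[of "\<lambda>p. pre_digraph.apath (with_proj H) u p v" _ length] by blast
qed

lemma strongly_resolves_end:
  assumes "wf_digraph (with_proj H)" "v \<rightarrow>\<^sup>*\<^bsub>with_proj H\<^esub> u"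
  shows "strongly_resolves H u u v"
proof -
  obtain p where p: "shortest_path H v p u"
    using shortest_path_exists[OF assms] by blast
  interpret H: wf_digraph "with_proj H" by fact
  have "H.awalk v p u"
    using p by (auto simp: shortest_path_def H.apath_def)
  then have "u \<in> set (H.awalk_verts v p)"
    by (metis H.awalkE H.awalk_verts_non_Nil last_in_set)
  with p show ?thesis
    unfolding strongly_resolves_def by blast
qed

text \<open>The two-arc path through \<open>v\<close> is shortest: the empty path is excluded by
  \<open>u \<noteq> w\<close>, a single arc by non-adjacency.\<close>

lemma strongly_resolves_adjacent:
  assumes "pair_wf_digraph H" "(u, v) \<in> parcs H" "(v, w) \<in> parcs H" "(u, w) \<notin> parcs H"
    and "distinct [u, v, w]"
  shows "strongly_resolves H w u v"
proof -
  interpret H: pair_wf_digraph H by fact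
  have "H.apath u [(u, v), (v, w)] w"
    using assms by (auto simp: H.apath_def H.awalk_def dest: H.wellformed')
  moreover have "length [(u, v), (v, w)] \<le> length q" if "H.apath u q w" for q
  proof (rule ccontr)
    assume "\<not> length [(u, v), (v, w)] \<le> length q"
    then have "q = [] \<or> (\<exists>e. q = [e])"
      by (cases q; cases "tl q") auto
    with that assms show False
      by (auto simp: H.apath_def H.awalk_def)
  qed
  ultimately have "shortest_path H u [(u, v), (v, w)] w"
    unfolding shortest_path_def by blast
  then show ?thesis
    unfolding strongly_resolves_def by force
qed

section \<open>Supergraphs with prescribed neighbourhoods in the resolving set\<close>

lemma threshold_strong_dimension_le:
  assumes "pair_graph H" "Digraph_Component.connected (with_proj H)"
    and "spanning (with_proj G) (with_proj H)" "strong_resolving_set H W"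
  shows "threshold_strong_dimension G \<le> card W"
proof -
  have "threshold_strong_dimension G \<le> strong_dimension H"
    unfolding threshold_strong_dimension_def using assms(1-3) by (intro Least_le) blast
  also have "\<dots> \<le> card W"
    unfolding strong_dimension_def using assms(4) by (intro Least_le) blast
  finally show ?thesis .
qed

text \<open>Take all edges except those joining some \<open>w\<close> in \<open>W\<close> to an
  \<open>x\<close> outside \<open>W\<close> with \<open>w \<notin> N x\<close>. Then
  \<open>N x\<close> is exactly the neighbourhood of \<open>x\<close> in \<open>W\<close>,
  \<open>arcs\<close> keeps the edges of \<open>G\<close>, and \<open>inj\<close> lets
  \<open>W\<close> resolve the pairs outside it.\<close>

lemma threshold_strong_dimension_le_card:
  fixes G :: "'a pair_pre_digraph" and N :: "'a \<Rightarrow> 'a set"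
  assumes G: "pair_graph G"
    and W: "W \<subseteq> pverts G"
    and x0: "x0 \<in> pverts G - W" "N x0 = W"
    and inj: "inj_on N (pverts G - W)"
    and N: "\<And>x. x \<in> pverts G - W \<Longrightarrow> N x \<subseteq> W"
    and arcs: "\<And>w x. (w, x) \<in> parcs G \<Longrightarrow> w \<in> W \<Longrightarrow> x \<notin> W \<Longrightarrow> w \<in> N x"
  shows "threshold_strong_dimension G \<le> card W"
proof -
  interpret G: pair_graph G by fact
  define A where "A = {(u, v). u \<in> pverts G \<and> v \<in> pverts G \<and> u \<noteq> v \<and>
    (u \<in> W \<and> v \<notin> W \<longrightarrow> u \<in> N v) \<and> (v \<in> W \<and> u \<notin> W \<longrightarrow> v \<in> N u)}"
  define H where "H = \<lparr>pverts = pverts G, parcs = A\<rparr>"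
  have verts_H [simp]: "pverts H = pverts G" and parcs_H [simp]: "parcs H = A"
    by (simp_all add: H_def)
  have "A \<subseteq> pverts G \<times> pverts G"
    by (auto simp: A_def)
  then have fin: "finite A"
    using G.pair_finite_verts finite_subset by blast
  interpret H: pair_graph H
  proof
    show "symmetric (with_proj H)"
      by (auto simp: symmetric_def sym_def A_def)
  qed (use fin G.pair_finite_verts in \<open>auto simp: A_def\<close>)
  have "pair_graph H" ..
  \<comment> \<open>\<open>N x0 = W\<close> makes \<open>x0\<close> universal, so any two vertices
    are joined through it.\<close>
  have univ: "(u, x0) \<in> A" "(x0, u) \<in> A" if "u \<in> pverts G" "u \<noteq> x0" for u
    using that x0 by (auto simp: A_def)
  have reach_x0: "u \<rightarrow>\<^sup>*\<^bsub>with_proj H\<^esub> x0" "x0 \<rightarrow>\<^sup>*\<^bsub>with_proj H\<^esub> u" if "u \<in> pverts G" for u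
    using that univ[of u] by (cases "u = x0"; force)+
  have reach: "u \<rightarrow>\<^sup>*\<^bsub>with_proj H\<^esub> v" if "u \<in> pverts G" "v \<in> pverts G" for u v
    using reach_x0 that H.reachable_trans by blast
  have conn: "Digraph_Component.connected (with_proj H)"
    using reach x0 by (intro H.connectedI H.reachable_mk_symmetricI) auto
  have "parcs G \<subseteq> A"
    using arcs G.arcs_symmetric by (auto simp: A_def dest: G.wellformed' G.no_loops')
  then have span: "spanning (with_proj G) (with_proj H)"
    using G.wf_digraph H.wf_digraph
    by (auto simp: spanning_def subgraph_def compatible_def)
  \<comment> \<open>\<open>u\<close> and \<open>v\<close> are adjacent, since both lie outside
    \<open>W\<close>, and \<open>w\<close> is a neighbour of \<open>v\<close> only.\<close>
  have sep: "\<exists>w\<in>W. strongly_resolves H w u v"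
    if "u \<in> pverts G - W" "v \<in> pverts G - W" "w \<in> N v" "w \<notin> N u" for u v w
  proof -
    have "w \<in> W" using that N by blast
    moreover have "strongly_resolves H w u v"
      by (rule strongly_resolves_adjacent)
        (use that \<open>w \<in> W\<close> W in \<open>auto simp: A_def\<close>)
    ultimately show ?thesis by blast
  qed
  have sym: "strongly_resolves H w u v \<longleftrightarrow> strongly_resolves H w v u" for u v w
    unfolding strongly_resolves_def by blast
  have "\<exists>w\<in>W. strongly_resolves H w u v" if uv: "u \<in> pverts G" "v \<in> pverts G" "u \<noteq> v" for u v
  proof (cases "u \<in> W \<or> v \<in> W")
    case True
    then show ?thesis
      using strongly_resolves_end[OF H.wf_digraph reach] uv sym by blast
  next
    case False
    then have "N u \<noteq> N v"
      using inj uv by (auto dest: inj_onD)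
    then show ?thesis
      using sep[of u v] sep[of v u] sym False uv by blast
  qed
  then have "strong_resolving_set H W"
    using W by (simp add: strong_resolving_set_def)
  then show ?thesis
    using threshold_strong_dimension_le[OF \<open>pair_graph H\<close> conn span] by blast
qed

section \<open>Assembling the resolving set from the colour classes\<close>

text \<open>\<open>W\<close> is what a class \<open>V\<close> contributes to the resolving set, and
  \<open>S x\<close> is the intended neighbourhood of \<open>x\<close> inside \<open>W\<close>. The
  vertex \<open>x0\<close>, which may lie outside \<open>V\<close>, is exempt because it becomes
  universal.\<close>

definition separated_off :: "'a \<Rightarrow> 'a set \<Rightarrow> 'a set \<Rightarrow> ('a \<Rightarrow> 'a set) \<Rightarrow> bool" where
  "separated_off x0 V W S \<longleftrightarrow> W \<subseteq> V - {x0} \<and>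
     inj_on S (V - W - {x0}) \<and> (\<forall>x \<in> V - W - {x0}. S x \<subset> W)"

text \<open>A vertex other than \<open>x0\<close> sees every chosen vertex of the other classes and
  only \<open>S (c x) x\<close> in its own. Injectivity of \<open>S\<close> separates vertices
  within a class, properness of its values all other pairs.\<close>

lemma threshold_strong_dimension_le_sum:
  fixes G :: "'a pair_pre_digraph"
  assumes G: "pair_graph G" and c: "proper_colouring G k c"
    and x0: "x0 \<in> pverts G"
    and sep: "\<And>i. i \<in> {1..k} \<Longrightarrow> \<exists>W S. separated_off x0 (colour_class G c i) W S \<and> card W = m i"
  shows "threshold_strong_dimension G \<le> (\<Sum>i = 1..k. m i)"
proof -
  interpret G: pair_graph G by fact
  obtain U S where US: "\<And>i. i \<in> {1..k} \<Longrightarrow> separated_off x0 (colour_class G c i) (U i) (S i)"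
      and card_U: "\<And>i. i \<in> {1..k} \<Longrightarrow> card (U i) = m i"
    using sep by metis
  define W where "W = (\<Union>i\<in>{1..k}. U i)"
  define N where
    "N x = (if x = x0 then W else {w \<in> W. c w \<noteq> c x} \<union> S (c x) x)" for x
  have U: "U i \<subseteq> colour_class G c i - {x0}" if "i \<in> {1..k}" for i
    using US[OF that] by (simp add: separated_off_def)
  have ck: "c x \<in> {1..k}" if "x \<in> pverts G" for x
    using c that by (simp add: proper_colouring_def)
  have WU: "x \<in> W \<longleftrightarrow> x \<in> U (c x)" if "x \<in> pverts G" for x
    using U ck[OF that] by (fastforce simp: W_def colour_class_def)
  have W: "W \<subseteq> pverts G - {x0}"
    using U by (fastforce simp: W_def colour_class_def)
  have rest: "x \<in> colour_class G c (c x) - U (c x) - {x0}"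
    if "x \<in> pverts G - W" "x \<noteq> x0" for x
    using that WU by (auto simp: colour_class_def)
  have S: "S (c x) x \<subset> U (c x)" if "x \<in> pverts G - W" "x \<noteq> x0" for x
    using US[OF ck, of x] rest[OF that] that by (auto simp: separated_off_def)
  \<comment> \<open>Restricting to the own colour recovers \<open>S\<close> from \<open>N\<close>,
    so equal neighbourhoods within a class force equal values of \<open>S\<close>.\<close>
  have NW: "N x \<inter> {w. c w = c x} = S (c x) x" if "x \<in> pverts G - W" "x \<noteq> x0" for x
    using S[OF that] U[OF ck, of x] that by (auto simp: N_def colour_class_def)
  have missing: "\<exists>w\<in>W. c w = c x \<and> w \<notin> N x" if x: "x \<in> pverts G - W" "x \<noteq> x0" for x
  proof -
    obtain w where w: "w \<in> U (c x)" "w \<notin> S (c x) x"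
      using S[OF x] by blast
    then have "c w = c x" "w \<in> W"
      using U[OF ck, of x] ck[of x] x by (auto simp: colour_class_def W_def)
    with w NW[OF x] show ?thesis by blast
  qed
  have "threshold_strong_dimension G \<le> card W"
  proof (rule threshold_strong_dimension_le_card[OF G])
    show "inj_on N (pverts G - W)"
    proof (rule inj_onI)
      fix x y
      assume x: "x \<in> pverts G - W" and y: "y \<in> pverts G - W" and eq: "N x = N y"
      consider "x = x0" "y = x0" | "x = x0" "y \<noteq> x0" | "x \<noteq> x0" "y = x0"
        | "x \<noteq> x0" "y \<noteq> x0" "c x = c y" | "x \<noteq> x0" "y \<noteq> x0" "c x \<noteq> c y"
        by blast
      then show "x = y"
      proof cases
        case 2
        then show ?thesis using missing[OF y] eq by (auto simp: N_def)
      next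
        case 3
        then show ?thesis using missing[OF x] eq by (auto simp: N_def)
      next
        case 4
        then have "S (c x) x = S (c x) y"
          using NW[OF x] NW[OF y] eq by auto
        moreover have "inj_on (S (c x)) (colour_class G c (c x) - U (c x) - {x0})"
          using US[OF ck, of x] x by (simp add: separated_off_def)
        ultimately show ?thesis
          using rest[OF x] rest[OF y] 4 by (auto dest: inj_onD)
      next
        case 5
        \<comment> \<open>This \<open>w\<close> has a colour different from \<open>c y\<close>, so
          it lies in \<open>N y\<close>.\<close>
        then obtain w where "w \<in> W" "c w = c x" "w \<notin> N x"
          using missing[OF x] by blast
        with 5 eq show ?thesis by (auto simp: N_def)
      qed simp
    qed
    show "N x \<subseteq> W" if "x \<in> pverts G - W" for x
    proof (cases "x = x0")
      case False
      then have "S (c x) x \<subseteq> U (c x)" "U (c x) \<subseteq> W"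
        using S[of x] that ck[of x] by (auto simp: W_def)
      with False show ?thesis by (auto simp: N_def)
    qed (simp add: N_def)
    \<comment> \<open>Arcs of \<open>G\<close> join different colours, and \<open>N\<close> omits
      chosen vertices of the own colour only.\<close>
    show "w \<in> N x" if "(w, x) \<in> parcs G" "w \<in> W" "x \<notin> W" for w x
      using c that by (auto simp: N_def proper_colouring_def)
  qed (use W x0 in \<open>auto simp: N_def\<close>)
  also have "card W \<le> (\<Sum>i = 1..k. card (U i))"
    unfolding W_def by (rule card_UN_le) simp
  also have "\<dots> = (\<Sum>i = 1..k. m i)"
    using card_U by simp
  finally show ?thesis .
qed

text \<open>A set of \<open>m\<close> vertices has \<open>2 ^ m - 1\<close> proper subsets, enough
  for the at most \<open>n - m\<close> remaining vertices when \<open>n \<le> 2 ^ m\<close> and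
  \<open>1 \<le> m\<close>.\<close>

lemma separated_off_log:
  assumes "2 \<le> card V"
  shows "\<exists>W S. separated_off x0 V W S \<and> card W = nat \<lceil>log 2 (real (card V))\<rceil>"
proof -
  define n where "n = card V"
  define m where "m = nat \<lceil>log 2 (real n)\<rceil>"
  have fin: "finite V" and n: "2 \<le> n"
    using assms by (auto simp: n_def intro: card_ge_0_finite)
  \<comment> \<open>So \<open>m\<close> is the least exponent with \<open>n \<le> 2 ^ m\<close>; the
    cases \<open>j = n - 1\<close>, \<open>j = 0\<close> and \<open>j = m\<close> give the bounds
    below.\<close>
  have pow: "n \<le> 2 ^ j \<longleftrightarrow> m \<le> j" for j
  proof -
    have "n \<le> 2 ^ j \<longleftrightarrow> real n \<le> 2 powr real j"
      by (metis of_nat_le_iff of_nat_numeral of_nat_power powr_realpow zero_less_numeral)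
    also have "\<dots> \<longleftrightarrow> log 2 (real n) \<le> real j"
      using n by (subst log_le_iff) auto
    also have "\<dots> \<longleftrightarrow> m \<le> j"
      unfolding m_def by (simp add: ceiling_le_iff)
    finally show ?thesis .
  qed
  have "n \<le> 2 ^ (n - 1)"
    using n less_exp[of "n - 1"] by linarith
  then have m_lt: "m \<le> n - 1"
    using pow by blast
  have m_pos: "1 \<le> m"
    using pow[of 0] n by (cases m) auto
  \<comment> \<open>If \<open>x0\<close> lies in \<open>V\<close>, only \<open>n - 1\<close>
    vertices are available for \<open>W\<close>; hence the bound
    \<open>m \<le> n - 1\<close>.\<close>
  have "n - 1 \<le> card (V - {x0})"
    by (simp add: n_def card_Diff_singleton_if)
  with m_lt have "m \<le> card (V - {x0})" by simp
  then obtain W where W: "W \<subseteq> V - {x0}" "card W = m" "finite W"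
    by (rule obtain_subset_with_card_n)
  have "card (V - W - {x0}) \<le> card (V - W)"
    using fin by (intro card_mono) auto
  also have "\<dots> = n - m"
    using W by (subst card_Diff_subset) (auto simp: n_def)
  \<comment> \<open>Moving at least one vertex into \<open>W\<close> makes up for the excluded
    subset \<open>W\<close> itself.\<close>
  also have "\<dots> \<le> 2 ^ m - 1"
    using pow[of m] m_pos by simp
  also have "\<dots> = card (Pow W - {W})"
    using W by (simp add: card_Pow)
  finally obtain S where "inj_on S (V - W - {x0})" "S ` (V - W - {x0}) \<subseteq> Pow W - {W}"
    using inj_on_iff_card_le[of "V - W - {x0}" "Pow W - {W}"] fin W by auto
  then have "separated_off x0 V W S"
    using W by (auto simp: separated_off_def)
  then show ?thesis
    using W by (auto simp: m_def n_def)
qed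

section \<open>Contributions of singleton and larger classes\<close>

lemma int_nat_ceiling_log:
  assumes "1 \<le> n"
  shows "int (nat \<lceil>log 2 (real n)\<rceil>) = \<lceil>log 2 (real n)\<rceil>"
proof -
  have "0 \<le> log 2 (real n)"
    using assms by simp
  then show ?thesis by linarith
qed

theorem theorem5p1:
  fixes G :: "'a pair_pre_digraph" and c :: "'a \<Rightarrow> nat" and k :: nat
  assumes "pair_graph G"
    and "\<not> (\<exists>n. complete_digraph n (with_proj G))"
    and "chromatic_number G = k"
    and "proper_colouring G k c"
    and "\<forall>i j. 1 \<le> i \<and> i \<le> j \<and> j \<le> k \<longrightarrow> card (colour_class G c i) \<le> card (colour_class G c j)"
  shows "(\<forall>l. 1 \<le> l \<and> l \<le> k \<and>
              (\<forall>i. 1 \<le> i \<and> i \<le> l \<longrightarrow> card (colour_class G c i) = 1) \<and>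
              (\<forall>i. l < i \<and> i \<le> k \<longrightarrow> card (colour_class G c i) > 1) \<longrightarrow>
              int (threshold_strong_dimension G)
                \<le> int l - 1 + (\<Sum>i = l + 1..k. \<lceil>log 2 (real (card (colour_class G c i)))\<rceil>)) \<and>
         (card (colour_class G c 1) \<ge> 2 \<longrightarrow>
              int (threshold_strong_dimension G)
                \<le> (\<Sum>i = 1..k. \<lceil>log 2 (real (card (colour_class G c i)))\<rceil>))"
proof (intro conjI allI impI)
  let ?V = "colour_class G c"
  fix l
  assume l: "1 \<le> l \<and> l \<le> k \<and> (\<forall>i. 1 \<le> i \<and> i \<le> l \<longrightarrow> card (?V i) = 1) \<and>
    (\<forall>i. l < i \<and> i \<le> k \<longrightarrow> card (?V i) > 1)"
  \<comment> \<open>The only vertex of class 1 serves as \<open>x0\<close> and costs nothing, which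
    gives the term -1. Every other singleton class costs 1, although its logarithm is 0.\<close>
  define m where
    "m i = (if i = 1 then 0 else if i \<le> l then 1 else nat \<lceil>log 2 (real (card (?V i)))\<rceil>)" for i
  obtain x0 where x0: "?V 1 = {x0}"
    using l card_1_singletonE by blast
  have "threshold_strong_dimension G \<le> (\<Sum>i = 1..k. m i)"
  proof (rule threshold_strong_dimension_le_sum[OF assms(1,4)])
    show "x0 \<in> pverts G"
      using x0 by (auto simp: colour_class_def)
    fix i assume i: "i \<in> {1..k}"
    consider "i = 1" | "1 < i" "i \<le> l" | "l < i" "i \<noteq> 1"
      using i l by fastforce
    then show "\<exists>W S. separated_off x0 (?V i) W S \<and> card W = m i"
    proof cases
      case 1
      then have "separated_off x0 (?V i) {} (\<lambda>_. {})"
        using x0 by (simp add: separated_off_def)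
      then show ?thesis using 1 by (intro exI[of _ "{}"]) (auto simp: m_def)
    next
      case 2
      then have "x0 \<notin> ?V i"
        using x0 by (auto simp: colour_class_def)
      \<comment> \<open>The single vertex itself joins the resolving set: an empty \<open>W\<close>
        would have no proper subset to assign to it.\<close>
      then have "separated_off x0 (?V i) (?V i) (\<lambda>_. {})"
        by (auto simp: separated_off_def)
      moreover have "card (?V i) = m i"
        using 2 l by (simp add: m_def)
      ultimately show ?thesis by blast
    next
      case 3
      then have "2 \<le> card (?V i)"
        using i l by (simp add: Suc_le_eq numeral_2_eq_2)
      then show ?thesis
        using separated_off_log[of "?V i" x0] 3 by (simp add: m_def)
    qed
  qed
  also have "(\<Sum>i = 1..k. m i) = (\<Sum>i = 1..l. m i) + (\<Sum>i = l + 1..k. m i)"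
    using l sum.ub_add_nat[of 1 l m "k - l"] by simp
  also have "(\<Sum>i = 1..l. m i) = l - 1"
    using l by (subst sum.atLeast_Suc_atMost) (auto simp: m_def)
  finally have "int (threshold_strong_dimension G) \<le> int l - 1 + (\<Sum>i = l + 1..k. int (m i))"
    using l unfolding of_nat_sum[symmetric] by linarith
  also have "(\<Sum>i = l + 1..k. int (m i)) = (\<Sum>i = l + 1..k. \<lceil>log 2 (real (card (?V i)))\<rceil>)"
    using l by (intro sum.cong refl) (auto simp: m_def less_imp_le int_nat_ceiling_log simp del: int_nat_eq)
  finally show "int (threshold_strong_dimension G)
    \<le> int l - 1 + (\<Sum>i = l + 1..k. \<lceil>log 2 (real (card (?V i)))\<rceil>)" .
next
  let ?V = "colour_class G c"
  assume two: "card (?V 1) \<ge> 2"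
  have ge: "2 \<le> card (?V i)" if "i \<in> {1..k}" for i
    using assms(5) two that by (meson atLeastAtMost_iff le_trans order_refl)
  \<comment> \<open>The logarithmic bound already leaves room for \<open>x0\<close> in its class, so
    here its choice saves nothing in the sum.\<close>
  obtain x0 where x0: "x0 \<in> ?V 1"
    using two by fastforce
  have "threshold_strong_dimension G \<le> (\<Sum>i = 1..k. nat \<lceil>log 2 (real (card (?V i)))\<rceil>)"
    using x0 separated_off_log[OF ge]
    by (intro threshold_strong_dimension_le_sum[OF assms(1,4), of x0]) (auto simp: colour_class_def)
  then have "int (threshold_strong_dimension G) \<le> (\<Sum>i = 1..k. int (nat \<lceil>log 2 (real (card (?V i)))\<rceil>))"
    unfolding of_nat_sum[symmetric] by linarith
  also have "\<dots> = (\<Sum>i = 1..k. \<lceil>log 2 (real (card (?V i)))\<rceil>)"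
    by (intro sum.cong refl int_nat_ceiling_log) (use ge in force)
  finally show "int (threshold_strong_dimension G)
    \<le> (\<Sum>i = 1..k. \<lceil>log 2 (real (card (?V i)))\<rceil>)" .
qed

end
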